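(* There is an absolute constant $c>0$ such that for all sufficiently large $n$, the number of labelled $n$-vertex intersection graphs of $x$-monotone pseudo-segments in the plane is at least $2^{c n^{4/3}}$.
   Context: A curve is a subset of the plane $\mathbb{R}^2$ homeomorphic to the interval $[0,1]$. A curve is $x$-monotone if every vertical line intersects it in at most one point. A collection of curves is a collection of pseudo-segments if every pair of them have at most one point in common. A labelled $n$-vertex intersection graph of curves of a given kind is a graph $G$ on the vertex set $\{1,\dots,n\}$ for which there is a collection $\gamma_1,\dots,\gamma_n$ of curves of that kind such that distinct $i,j$ are adjacent in $G$ if and only if $\gamma_i\cap\gamma_j\neq\emptyset$. Labelled graphs are counted as distinct if their edge sets differ. *)

theory Defs
  imports "HOL-Analysis.Analysis"
begin

type_synonym plane = "real \<times> real"

definition curve :: "plane set \<Rightarrow> bool" where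
  "curve C \<longleftrightarrow> C homeomorphic {0..1::real}"

definition vertical_line :: "real \<Rightarrow> plane set" where
  "vertical_line x = {p. fst p = x}"

definition x_monotone :: "plane set \<Rightarrow> bool" where
  "x_monotone C \<longleftrightarrow> (\<forall>x. \<exists>\<^sub>\<le>\<^sub>1 p. p \<in> C \<inter> vertical_line x)"

text \<open>Collections are indexed families: curves with different indices have at most one
  common point, so in particular they are different curves.\<close>

definition pseudo_segments :: "'i set \<Rightarrow> ('i \<Rightarrow> plane set) \<Rightarrow> bool" where
  "pseudo_segments I \<gamma> \<longleftrightarrow>
     (\<forall>i\<in>I. curve (\<gamma> i)) \<and>
     (\<forall>i\<in>I. \<forall>j\<in>I. i \<noteq> j \<longrightarrow> (\<exists>\<^sub>\<le>\<^sub>1 p. p \<in> \<gamma> i \<inter> \<gamma> j))"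

definition x_monotone_pseudo_segments :: "'i set \<Rightarrow> ('i \<Rightarrow> plane set) \<Rightarrow> bool" where
  "x_monotone_pseudo_segments I \<gamma> \<longleftrightarrow>
     pseudo_segments I \<gamma> \<and> (\<forall>i\<in>I. x_monotone (\<gamma> i))"

text \<open>A labelled graph on the vertex set \<open>{1..n}\<close> is given by its edge set, a set of
  two-element subsets of \<open>{1..n}\<close>.\<close>

definition intersection_edges :: "'i set \<Rightarrow> ('i \<Rightarrow> 'b set) \<Rightarrow> 'i set set" where
  "intersection_edges I \<gamma> = {{i, j} | i j. i \<in> I \<and> j \<in> I \<and> i \<noteq> j \<and> \<gamma> i \<inter> \<gamma> j \<noteq> {}}"

definition x_monotone_pseudo_segment_graphs :: "nat \<Rightarrow> nat set set set" where
  "x_monotone_pseudo_segment_graphs n =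
     {E. \<exists>\<gamma>. x_monotone_pseudo_segments {1..n} \<gamma> \<and> E = intersection_edges {1..n} \<gamma>}"

text \<open>The cardinality of this set is a genuine count: the set is finite.\<close>

lemma finite_x_monotone_pseudo_segment_graphs:
  "finite (x_monotone_pseudo_segment_graphs n)"
proof (rule finite_subset)
  show "x_monotone_pseudo_segment_graphs n \<subseteq> Pow (Pow {1..n})"
    unfolding x_monotone_pseudo_segment_graphs_def intersection_edges_def by auto
qed simp

end

theory Submission
  imports Defs
begin

text \<open>
  Take a configuration of about \<open>n\<close> points and lines with \<open>\<Theta>(n powr (4/3))\<close> incidences and
  show that every incidence can be destroyed independently of all others. Since the
  resulting intersection graphs are told apart by the surviving incidences, there are at
  least \<open>2\<close> to the number of incidences many of them.

  The configuration is the standard grid: the lines \<open>y = a x + b\<close> with \<open>a < k\<close>, \<open>b < k\<^sup>2\<close>, and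
  the points \<open>(x, y)\<close> with \<open>x < k\<close>, \<open>y < 2 k\<^sup>2\<close>. Each of the \<open>k\<^sup>3\<close> lines contains one point in
  each of the \<open>k\<close> columns, so there are \<open>k\<^sup>4\<close> incidences on \<open>3 k\<^sup>3\<close> objects.

  A point is replaced by a very short segment of slope \<open>k\<close> starting there, steeper than all
  the lines. To destroy the incidence of a line with its point in column \<open>j\<close>, a tent
  function centred at \<open>j\<close> is added to the line; it vanishes in all other columns. The tents
  are scaled so that their sum \<open>bend\<close> has values in \<open>[0, 1/4]\<close> and Lipschitz constant
  \<open>1/4\<close>. Since slopes of non-parallel lines differ by at least \<open>1\<close>, the difference of two
  bent lines is still strictly monotone, and parallel lines, at vertical distance at least
  \<open>1\<close>, remain disjoint: whatever incidences are destroyed, the family consists of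
  pseudo-segments.
\<close>

section \<open>Graphs of functions as curves\<close>

definition graph_over :: "real set \<Rightarrow> (real \<Rightarrow> real) \<Rightarrow> plane set" where
  "graph_over S f = (\<lambda>x. (x, f x)) ` S"

lemma mem_graph_over_iff: "p \<in> graph_over S f \<longleftrightarrow> fst p \<in> S \<and> snd p = f (fst p)"
  unfolding graph_over_def by (cases p) auto

lemma x_monotone_graph_over: "x_monotone (graph_over S f)"
  unfolding x_monotone_def vertical_line_def
  by (auto intro!: Uniq_I simp: mem_graph_over_iff prod_eq_iff)

lemma curve_graph_over:
  assumes "a < b" and "continuous_on {a..b} f"
  shows "curve (graph_over {a..b} f)"
proof -
  have "{a..b} homeomorphic graph_over {a..b} f"
    unfolding homeomorphic_def homeomorphism_def
  proof (intro exI conjI)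
    show "continuous_on {a..b} (\<lambda>x. (x, f x))"
      by (intro continuous_intros assms)
    show "continuous_on (graph_over {a..b} f) fst"
      by (intro continuous_intros)
  qed (force simp: graph_over_def)+
  moreover have "{a..b} homeomorphic {0..1::real}"
    using homeomorphic_closed_intervals_real[of a b 0 1] assms(1) by simp
  ultimately show ?thesis
    unfolding curve_def using homeomorphic_sym homeomorphic_trans by blast
qed

text \<open>Common points lie over the zeros of \<open>f - g\<close>, and a strictly increasing function has one
  zero at most.\<close>

lemma Uniq_common_point_graphs:
  assumes "\<And>s t. s \<in> S \<inter> T \<Longrightarrow> t \<in> S \<inter> T \<Longrightarrow> s < t \<Longrightarrow> f s - g s < f t - g t"
  shows "\<exists>\<^sub>\<le>\<^sub>1 p. p \<in> graph_over S f \<inter> graph_over T g"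
proof (rule Uniq_I)
  fix p q
  assume *: "p \<in> graph_over S f \<inter> graph_over T g" "q \<in> graph_over S f \<inter> graph_over T g"
  then have "fst p \<in> S \<inter> T" "fst q \<in> S \<inter> T"
    "f (fst p) - g (fst p) = 0" "f (fst q) - g (fst q) = 0"
    by (auto simp: mem_graph_over_iff)
  with assms have "fst q = fst p"
    by (metis less_irrefl linorder_neqE)
  with * show "q = p"
    by (auto simp: mem_graph_over_iff prod_eq_iff)
qed

section \<open>Counting graphs by independent adjacencies\<close>

lemma mem_intersection_edges_iff:
  assumes "i \<in> I" "j \<in> I" "i \<noteq> j"
  shows "{i, j} \<in> intersection_edges I \<gamma> \<longleftrightarrow> \<gamma> i \<inter> \<gamma> j \<noteq> {}"
  using assms unfolding intersection_edges_def by (auto simp: doubleton_eq_iff)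

text \<open>
  If the adjacencies of the vertex pairs \<open>{u t, w t}\<close>, \<open>t \<in> X\<close>, can be prescribed
  arbitrarily, every subset of \<open>X\<close> gives another graph. The index set is arbitrary so that
  geometric objects can serve as indices; a bijection with \<open>{1..n}\<close> supplies the labels.
\<close>

lemma card_graphs_ge_power:
  assumes "finite I" and "card I = n" and "finite X"
    and vertices: "\<And>t. t \<in> X \<Longrightarrow> u t \<in> I \<and> w t \<in> I \<and> u t \<noteq> w t"
    and family: "\<And>D. D \<subseteq> X \<Longrightarrow> x_monotone_pseudo_segments I (\<gamma> D)"
    and adjacent: "\<And>D t. D \<subseteq> X \<Longrightarrow> t \<in> X \<Longrightarrow> \<gamma> D (u t) \<inter> \<gamma> D (w t) \<noteq> {} \<longleftrightarrow> t \<notin> D"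
  shows "2 ^ card X \<le> card (x_monotone_pseudo_segment_graphs n)"
proof -
  obtain h where h: "bij_betw h {1..n} I"
    using ex_bij_betw_nat_finite_1[OF \<open>finite I\<close>] \<open>card I = n\<close> by blast
  define E where "E D = intersection_edges {1..n} (\<gamma> D \<circ> h)" for D
  have "E D \<in> x_monotone_pseudo_segment_graphs n" if "D \<subseteq> X" for D
  proof -
    have "h i \<in> I" if "i \<in> {1..n}" for i
      using bij_betwE[OF h] that by blast
    moreover have "h i \<noteq> h j" if "i \<in> {1..n}" "j \<in> {1..n}" "i \<noteq> j" for i j
      using inj_onD[OF bij_betw_imp_inj_on[OF h]] that by blast
    ultimately have "x_monotone_pseudo_segments {1..n} (\<gamma> D \<circ> h)"
      using family[OF that]
      unfolding x_monotone_pseudo_segments_def pseudo_segments_def by auto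
    then show ?thesis
      unfolding x_monotone_pseudo_segment_graphs_def E_def by blast
  qed
  moreover have "inj_on E (Pow X)"
  proof (rule inj_onI)
    have deleted_iff: "t \<in> D \<longleftrightarrow>
        {inv_into {1..n} h (u t), inv_into {1..n} h (w t)} \<notin> E D" if "D \<subseteq> X" "t \<in> X" for D t
    proof -
      let ?i = "inv_into {1..n} h (u t)" and ?j = "inv_into {1..n} h (w t)"
      have hij: "h ?i = u t" "h ?j = w t"
        using h vertices[OF \<open>t \<in> X\<close>] by (simp_all add: bij_betw_inv_into_right)
      have "?i \<in> {1..n}" "?j \<in> {1..n}"
        using h vertices[OF \<open>t \<in> X\<close>]
        by (metis bij_betw_imp_surj_on inv_into_into)+
      moreover have "?i \<noteq> ?j"
        using hij vertices[OF \<open>t \<in> X\<close>] by metis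
      ultimately show ?thesis
        using adjacent[OF that] hij by (simp add: E_def mem_intersection_edges_iff)
    qed
    fix D D' assume "D \<in> Pow X" "D' \<in> Pow X" "E D = E D'"
    then show "D = D'"
      using deleted_iff by blast
  qed
  ultimately have "card (Pow X) \<le> card (x_monotone_pseudo_segment_graphs n)"
    by (intro card_inj_on_le[of E] finite_x_monotone_pseudo_segment_graphs) auto
  then show ?thesis
    by (simp add: card_Pow \<open>finite X\<close>)
qed

section \<open>Bent lines\<close>

definition tent :: "real \<Rightarrow> real" where
  "tent s = max 0 (1 - \<bar>s\<bar>)"

text \<open>
  The line with slope \<open>a\<close> and intercept \<open>b\<close> is lifted at the columns \<open>j\<close> with \<open>(a, b, j) \<in> D\<close>.
  With the factor \<open>1 / (4 k)\<close> crude bounds on a sum of \<open>k\<close> tents suffice.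
\<close>

definition bend :: "nat \<Rightarrow> (nat \<times> nat \<times> nat) set \<Rightarrow> nat \<Rightarrow> nat \<Rightarrow> real \<Rightarrow> real" where
  "bend k D a b s = (\<Sum>j<k. of_bool ((a, b, j) \<in> D) * tent (s - real j)) / (4 * real k)"

definition bent_line :: "nat \<Rightarrow> (nat \<times> nat \<times> nat) set \<Rightarrow> nat \<Rightarrow> nat \<Rightarrow> real \<Rightarrow> real" where
  "bent_line k D a b s = real a * s + real b + bend k D a b s"

lemma bend_bounds:
  shows "0 \<le> bend k D a b s" and "bend k D a b s \<le> 1 / 4"
proof -
  have "(\<Sum>j<k. of_bool ((a, b, j) \<in> D) * tent (s - real j)) \<le> (\<Sum>j<k. 1)"
    by (intro sum_mono) (auto simp: tent_def)
  then show "bend k D a b s \<le> 1 / 4"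
    by (cases "k = 0") (auto simp: bend_def divide_simps)
  show "0 \<le> bend k D a b s"
    unfolding bend_def by (intro divide_nonneg_nonneg sum_nonneg) (auto simp: tent_def)
qed

lemma bend_lipschitz: "\<bar>bend k D a b s - bend k D a b t\<bar> \<le> \<bar>s - t\<bar> / 4"
proof -
  let ?e = "\<lambda>j. of_bool ((a, b, j) \<in> D) :: real"
  have "\<bar>\<Sum>j<k. ?e j * tent (s - real j) - ?e j * tent (t - real j)\<bar> \<le> (\<Sum>j<k. \<bar>s - t\<bar>)"
    by (intro order_trans[OF sum_abs] sum_mono) (auto simp: tent_def)
  then have "\<bar>(\<Sum>j<k. ?e j * tent (s - real j)) - (\<Sum>j<k. ?e j * tent (t - real j))\<bar>
      \<le> real k * \<bar>s - t\<bar>"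
    by (simp add: sum_subtractf)
  then show ?thesis
    by (cases "k = 0") (auto simp: bend_def divide_simps mult_ac simp flip: diff_divide_distrib)
qed

text \<open>Tents centred at other columns vanish at column \<open>x\<close>, so only the own one counts.\<close>

lemma bend_at_column:
  assumes "x < k"
  shows "bend k D a b (real x) = of_bool ((a, b, x) \<in> D) / (4 * real k)"
proof -
  have "tent (real x - real j) = of_bool (j = x)" for j
    by (auto simp: tent_def)
  then have "(\<Sum>j<k. of_bool ((a, b, j) \<in> D) * tent (real x - real j))
      = (\<Sum>j<k. if j = x then of_bool ((a, b, x) \<in> D) else 0)"
    by (intro sum.cong) auto
  with assms show ?thesis
    by (simp add: bend_def)
qed

lemma continuous_on_bent_line:
  assumes "k \<noteq> 0"
  shows "continuous_on S (bent_line k D a b)"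
  unfolding bent_line_def[abs_def] bend_def[abs_def] tent_def
  by (intro continuous_intros) (use assms in auto)

lemma Uniq_common_point_bent_lines:
  assumes "(a, b) \<noteq> (a', b')"
  shows "\<exists>\<^sub>\<le>\<^sub>1 p. p \<in> graph_over S (bent_line k D a b) \<inter> graph_over T (bent_line k D a' b')"
proof -
  have steeper: "\<exists>\<^sub>\<le>\<^sub>1 p. p \<in> graph_over S (bent_line k D a b) \<inter> graph_over T (bent_line k D a' b')"
    if "a' < a" for a a' b b' S T
  proof (rule Uniq_common_point_graphs)
    fix s t :: real assume "s < t"
    have "1 * (t - s) \<le> (real a - real a') * (t - s)"
      using \<open>s < t\<close> that by (intro mult_right_mono) auto
    then show "bent_line k D a b s - bent_line k D a' b' s
        < bent_line k D a b t - bent_line k D a' b' t"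
      using bend_lipschitz[of k D a b s t] bend_lipschitz[of k D a' b' s t] \<open>s < t\<close>
      by (simp add: bent_line_def algebra_simps) argo
  qed
  consider "a' < a" | "a < a'" | "a = a'" "b \<noteq> b'"
    using assms by fastforce
  then show ?thesis
  proof cases
    case 1
    then show ?thesis by (rule steeper)
  next
    case 2
    then show ?thesis using steeper[of a a' T b' S b] by (simp add: Int_commute)
  next
    case 3
    then have "bent_line k D a b s \<noteq> bent_line k D a' b' s" for s
      using bend_bounds[of k D a b s] bend_bounds[of k D a' b' s]
      by (auto simp: bent_line_def)
    then show ?thesis by (auto simp: Uniq_def mem_graph_over_iff)
  qed
qed

section \<open>Short steep segments in place of points\<close>

text \<open>
  A bent line lifted at the point passes \<open>1 / (4 k)\<close> above it, and over a
  width \<open>d\<close> the segment gains at most \<open>(k + 1/4) d\<close> on it. The width \<open>1 / (16 k\<^sup>2)\<close> keeps this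
  gain below \<open>1 / (4 k)\<close>.
\<close>

definition point_segment :: "nat \<Rightarrow> nat \<Rightarrow> nat \<Rightarrow> plane set" where
  "point_segment k x y =
     graph_over {real x..real x + 1 / (16 * real k ^ 2)} (\<lambda>s. real y + real k * (s - real x))"

lemma Uniq_common_point_point_segments:
  assumes "(x, y) \<noteq> (x', y')" and "k \<noteq> 0"
  shows "\<exists>\<^sub>\<le>\<^sub>1 p. p \<in> point_segment k x y \<inter> point_segment k x' y'"
proof -
  have width: "1 / (16 * real k ^ 2) < 1"
  proof -
    have "1 \<le> real k ^ 2"
      using \<open>k \<noteq> 0\<close> by (intro one_le_power) simp
    then show ?thesis
      by (simp add: divide_simps)
  qed
  have False if "p \<in> point_segment k x y \<inter> point_segment k x' y'" for p
  proof -
    have "real x \<le> fst p" "fst p \<le> real x + 1 / (16 * real k ^ 2)"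
      "real x' \<le> fst p" "fst p \<le> real x' + 1 / (16 * real k ^ 2)"
      and height: "real y + real k * (fst p - real x) = real y' + real k * (fst p - real x')"
      using that by (auto simp: point_segment_def mem_graph_over_iff)
    then have "real x < real x' + 1" "real x' < real x + 1"
      using width by linarith+
    then have "x = x'"
      by linarith
    with height assms(1) show False
      by simp
  qed
  then show ?thesis by (auto simp: Uniq_def)
qed

lemma Uniq_common_point_segment_bent_line:
  assumes "a < k"
  shows "\<exists>\<^sub>\<le>\<^sub>1 p. p \<in> point_segment k x y \<inter> graph_over S (bent_line k D a b)"
  unfolding point_segment_def
proof (rule Uniq_common_point_graphs)
  fix s t :: real assume "s < t"
  have "1 * (t - s) \<le> (real k - real a) * (t - s)"
    using \<open>s < t\<close> assms by (intro mult_right_mono) auto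
  then show "real y + real k * (s - real x) - bent_line k D a b s
      < real y + real k * (t - real x) - bent_line k D a b t"
    using bend_lipschitz[of k D a b s t] \<open>s < t\<close>
    by (simp add: bent_line_def algebra_simps) argo
qed

text \<open>
  If the incidence is kept, the bent line still passes through the grid point; if it is
  deleted, the line starts too high above the point for the short segment to reach it.
\<close>

lemma incidence_survives_iff:
  assumes "x < k"
  shows "graph_over {0..real k} (bent_line k D a b) \<inter> point_segment k x (a * x + b) \<noteq> {}
    \<longleftrightarrow> (a, b, x) \<notin> D"
proof (cases "(a, b, x) \<in> D")
  case True
  have "bent_line k D a b s > real (a * x + b) + real k * (s - real x)"
    if s: "real x \<le> s" "s \<le> real x + 1 / (16 * real k ^ 2)" for s
  proof -
    have "1 / (4 * real k) \<le> bend k D a b s + (s - real x) / 4"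
      using bend_lipschitz[of k D a b s "real x"] bend_at_column[OF assms, of D a b] True s
      by simp argo
    moreover have "(real k + 1 / 4) * (s - real x) \<le> (2 * real k) * (1 / (16 * real k ^ 2))"
      using assms s by (intro mult_mono) auto
    moreover have "(2 * real k) * (1 / (16 * real k ^ 2)) < 1 / (4 * real k)"
      using assms by (simp add: divide_simps power2_eq_square)
    moreover have "0 \<le> real a * (s - real x)"
      using s by simp
    ultimately show ?thesis
      by (simp add: bent_line_def algebra_simps)
  qed
  with True show ?thesis
    by (auto simp: point_segment_def mem_graph_over_iff) force
next
  case False
  then have "(real x, real (a * x + b))
      \<in> graph_over {0..real k} (bent_line k D a b) \<inter> point_segment k x (a * x + b)"
    using assms by (simp add: point_segment_def mem_graph_over_iff bent_line_def bend_at_column)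
  with False show ?thesis by blast
qed

section \<open>The grid configuration\<close>

text \<open>\<open>Inl (a, b)\<close> stands for the line of slope \<open>a\<close> and intercept \<open>b\<close>, \<open>Inr (x, y)\<close> for a point.\<close>

fun grid_curve :: "nat \<Rightarrow> (nat \<times> nat \<times> nat) set \<Rightarrow> nat \<times> nat + nat \<times> nat \<Rightarrow> plane set" where
  "grid_curve k D (Inl (a, b)) = graph_over {0..real k} (bent_line k D a b)"
| "grid_curve k D (Inr (x, y)) = point_segment k x y"

text \<open>
  Intercepts and points are not restricted to the grid, so that the family can be enlarged
  to any prescribed number of curves.
\<close>

lemma x_monotone_pseudo_segments_grid_curve:
  assumes "k \<noteq> 0" and I: "I \<subseteq> Inl ` ({..<k} \<times> UNIV) \<union> range Inr"
  shows "x_monotone_pseudo_segments I (grid_curve k D)"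
proof -
  have "curve (grid_curve k D i) \<and> x_monotone (grid_curve k D i)" for i
  proof (cases "(k, D, i)" rule: grid_curve.cases)
    case (1 _ _ a b)
    then show ?thesis
      using \<open>k \<noteq> 0\<close>
      by (simp add: x_monotone_graph_over curve_graph_over continuous_on_bent_line)
  next
    case (2 _ _ x y)
    have "continuous_on S (\<lambda>s. real y + real k * (s - real x))" for S
      by (intro continuous_intros)
    with 2 show ?thesis
      using \<open>k \<noteq> 0\<close> by (simp add: point_segment_def x_monotone_graph_over curve_graph_over)
  qed
  moreover have "\<exists>\<^sub>\<le>\<^sub>1 p. p \<in> grid_curve k D i \<inter> grid_curve k D j"
    if "i \<in> I" "j \<in> I" "i \<noteq> j" for i j
  proof -
    have line_point: "\<exists>\<^sub>\<le>\<^sub>1 p. p \<in> grid_curve k D (Inr (x, y)) \<inter> grid_curve k D (Inl (a, b))"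
      if "Inl (a, b) \<in> I" for a b x y
      using that I unfolding grid_curve.simps
      by (intro Uniq_common_point_segment_bent_line) auto
    consider a b a' b' where "i = Inl (a, b)" "j = Inl (a', b')"
      | a b x y where "i = Inl (a, b)" "j = Inr (x, y)"
      | x y a b where "i = Inr (x, y)" "j = Inl (a, b)"
      | x y x' y' where "i = Inr (x, y)" "j = Inr (x', y')"
      by (metis obj_sumE surj_pair)
    then show ?thesis
    proof cases
      case 1
      then show ?thesis
        using \<open>i \<noteq> j\<close> Uniq_common_point_bent_lines[of a b a' b'] by simp
    next
      case 2
      then show ?thesis
        using \<open>i \<in> I\<close> line_point[of a b x y] by (simp only: Int_commute)
    next
      case 3
      then show ?thesis
        using \<open>j \<in> I\<close> line_point by simp
    next
      case 4
      then show ?thesis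
        using \<open>i \<noteq> j\<close> Uniq_common_point_point_segments[OF _ \<open>k \<noteq> 0\<close>, of x y x' y'] by simp
    qed
  qed
  ultimately show ?thesis
    unfolding x_monotone_pseudo_segments_def pseudo_segments_def by blast
qed

lemma card_graphs_ge_grid:
  assumes "k \<noteq> 0" and "3 * k ^ 3 \<le> n"
  shows "2 ^ (k ^ 4) \<le> card (x_monotone_pseudo_segment_graphs n)"
proof -
  define objects where "objects m =
    Inl ` ({..<k} \<times> {..<k ^ 2}) \<union> Inr ` ({..<k} \<times> {..<m})" for m :: nat
  define X where "X = {..<k} \<times> {..<k ^ 2} \<times> {..<k}"
  have finite: "finite (objects m)" for m
    by (simp add: objects_def)
  have card: "card (objects m) = k ^ 3 + k * m" for m
    unfolding objects_def
    by (subst card_Un_disjoint)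
       (auto simp: card_image card_cartesian_product power2_eq_square power3_eq_cube)
  \<comment> \<open>Points above the grid fill the vertex set up to exactly \<open>n\<close> vertices.\<close>
  have "card (objects (2 * k ^ 2)) \<le> n"
    unfolding card using assms(2) by (simp add: power2_eq_square power3_eq_cube)
  moreover have "n \<le> card (objects (2 * k ^ 2 + n))"
    unfolding card using assms(1)
    by (metis add_leE mult_le_mono1 nat_mult_1 less_one not_le trans_le_add2)
  moreover have "objects (2 * k ^ 2) \<subseteq> objects (2 * k ^ 2 + n)"
    by (auto simp: objects_def)
  ultimately obtain I where I: "objects (2 * k ^ 2) \<subseteq> I" "I \<subseteq> objects (2 * k ^ 2 + n)" "card I = n"
    using exists_subset_between finite by metis
  have "2 ^ card X \<le> card (x_monotone_pseudo_segment_graphs n)"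
  proof (rule card_graphs_ge_power[where I = I and \<gamma> = "grid_curve k" and
        u = "\<lambda>(a, b, x). Inl (a, b)" and w = "\<lambda>(a, b, x). Inr (x, a * x + b)"])
    show "finite I" "card I = n"
      using I finite_subset[OF _ finite] by blast+
    show "finite X"
      by (simp add: X_def)
    have "a * x + b < 2 * k ^ 2" if "a < k" "b < k ^ 2" "x < k" for a b x
      using mult_strict_mono'[OF \<open>a < k\<close> \<open>x < k\<close>] that by (simp add: power2_eq_square)
    then show "(case t of (a, b, x) \<Rightarrow> Inl (a, b)) \<in> I \<and>
        (case t of (a, b, x) \<Rightarrow> Inr (x, a * x + b)) \<in> I \<and>
        (case t of (a, b, x) \<Rightarrow> Inl (a, b)) \<noteq> (case t of (a, b, x) \<Rightarrow> Inr (x, a * x + b))"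
      if "t \<in> X" for t
      using that I(1) by (auto simp: X_def objects_def)
    show "x_monotone_pseudo_segments I (grid_curve k D)" for D
      using I(2) by (intro x_monotone_pseudo_segments_grid_curve assms) (auto simp: objects_def)
    show "grid_curve k D (case t of (a, b, x) \<Rightarrow> Inl (a, b)) \<inter>
        grid_curve k D (case t of (a, b, x) \<Rightarrow> Inr (x, a * x + b)) \<noteq> {} \<longleftrightarrow> t \<notin> D"
      if "t \<in> X" for D t
    proof -
      obtain a b x where t: "t = (a, b, x)"
        by (cases t)
      with that have "x < k"
        by (simp add: X_def)
      then show ?thesis
        unfolding t prod.case grid_curve.simps by (rule incidence_survives_iff)
    qed
  qed
  moreover have "card X = k ^ 4"
    by (simp add: X_def card_cartesian_product power2_eq_square power4_eq_xxxx)
  ultimately show ?thesis by simp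
qed

text \<open>
  The largest \<open>k\<close> with \<open>3 k\<^sup>3 \<le> n\<close> satisfies \<open>n < 3 (k + 1)\<^sup>3 \<le> 24 k\<^sup>3 \<le> (3 k)\<^sup>3\<close>, hence
  \<open>n powr (4/3) \<le> (3 k)\<^sup>4 = 81 k\<^sup>4\<close>; this is the source of the constant \<open>1/81\<close>.
\<close>

theorem theorem1p1:
  shows "\<exists>c::real. c > 0 \<and>
    (\<forall>\<^sub>F n in sequentially.
       real (card (x_monotone_pseudo_segment_graphs n)) \<ge> 2 powr (c * real n powr (4/3)))"
proof (intro exI conjI)
  show "(0::real) < 1 / 81" by simp
  show "\<forall>\<^sub>F n in sequentially.
      real (card (x_monotone_pseudo_segment_graphs n)) \<ge> 2 powr (1 / 81 * real n powr (4/3))"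
    using eventually_ge_at_top[of 3]
  proof eventually_elim
    case (elim n)
    have "n < 3 * (n + 1) ^ 3"
      by (simp add: power3_eq_cube algebra_simps)
    then obtain k where below: "\<forall>i\<le>k. \<not> n < 3 * i ^ 3" and "n < 3 * Suc k ^ 3"
      using ex_least_nat_less[of "\<lambda>m. n < 3 * m ^ 3" "n + 1"] by auto
    have "k \<noteq> 0"
      using \<open>n < 3 * Suc k ^ 3\<close> elim by (intro notI) simp
    have "n < 3 * Suc k ^ 3" by fact
    also have "\<dots> \<le> 3 * (2 * k) ^ 3"
      using \<open>k \<noteq> 0\<close> by (intro mult_le_mono power_mono) auto
    also have "\<dots> \<le> (3 * k) ^ 3"
      by (simp add: power_mult_distrib)
    finally have "real n \<le> real ((3 * k) ^ 3)"
      by (simp only: of_nat_le_iff)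
    then have "real n powr (4/3) \<le> (real (3 * k) powr 3) powr (4/3)"
      using \<open>k \<noteq> 0\<close> by (intro powr_mono2) (auto simp: power_mult_distrib)
    also have "\<dots> = real (3 * k) powr 4"
      unfolding powr_powr by simp
    also have "\<dots> = 81 * real k ^ 4"
      using \<open>k \<noteq> 0\<close> by (simp add: power_mult_distrib)
    finally have "2 powr (1 / 81 * real n powr (4/3)) \<le> 2 powr real (k ^ 4)"
      by (intro powr_mono) auto
    also have "\<dots> = real (2 ^ (k ^ 4))"
      by (simp add: powr_realpow del: of_nat_power)
    also have "\<dots> \<le> real (card (x_monotone_pseudo_segment_graphs n))"
      using card_graphs_ge_grid[OF \<open>k \<noteq> 0\<close>, of n] below
      by (simp only: of_nat_le_iff not_less)
    finally show ?case .
  qed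
qed

end
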